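(* Let $I\subset\mathbb{R}$ be a compact interval. If $\phi :I\rightarrow \mathbb{R}$ satisfies the Zygmund condition, then $\phi$ is of bounded Zygmund variation and of bounded quadratic variation over the interval $I$.
   Context: A continuous function $\phi:I\to\mathbb{R}$ satisfies the Zygmund condition if there exists $B>0$ such that $$\sup_{x,t}\left|\frac{\phi(x+t)+\phi(x-t)-2\phi(x)}{t}\right|\le B,$$ where the supremum is over all $x$ and $t\neq 0$ with $x-t,x,x+t\in I$. A continuous $\phi:I\to\mathbb{R}$ is of bounded Zygmund variation on $I$ if there is $B>0$ with $$\sup_{\{x_0,\dots,x_n\}}\sum_{i=0}^{n-1}\left|\phi(x_i)+\phi(x_{i+1})-2\phi\left(\tfrac{x_i+x_{i+1}}{2}\right)\right|\le B,$$ where the supremum is over all partitions $x_0<x_1<\dots<x_n$ of $I$ (with $x_0,x_n$ the endpoints of $I$). A continuous $\phi:I\to\mathbb{R}$ is of bounded quadratic variation on $I$ if there is $B>0$ with $$\sup_{\{x_0,\dots,x_n\}}\sum_{i=0}^{n-1}(\phi(x_{i+1})-\phi(x_i))^2\le B,$$ with the supremum over all partitions of $I$. *)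

theory Defs
  imports "HOL-Analysis.Analysis"
begin

text \<open>Each bound on a supremum is written as a bound on all its members: the real-valued
  \<^const>\<open>Sup\<close> is unspecified on sets that are not bounded above.\<close>

definition zygmund_condition :: "real set \<Rightarrow> (real \<Rightarrow> real) \<Rightarrow> bool" where
  "zygmund_condition I \<phi> \<longleftrightarrow>
     continuous_on I \<phi> \<and>
     (\<exists>B>0. \<forall>x t. t \<noteq> 0 \<and> x - t \<in> I \<and> x \<in> I \<and> x + t \<in> I \<longrightarrow>
        \<bar>(\<phi> (x + t) + \<phi> (x - t) - 2 * \<phi> x) / t\<bar> \<le> B)"

text \<open>Only the values \<open>x 0, \<dots>, x n\<close> matter. The case \<open>n = 0\<close> occurs only for \<open>a = b\<close>.\<close>

definition interval_partition :: "real \<Rightarrow> real \<Rightarrow> nat \<Rightarrow> (nat \<Rightarrow> real) \<Rightarrow> bool" where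
  "interval_partition a b n x \<longleftrightarrow> strict_mono_on {0..n} x \<and> x 0 = a \<and> x n = b"

definition bounded_zygmund_variation :: "real \<Rightarrow> real \<Rightarrow> (real \<Rightarrow> real) \<Rightarrow> bool" where
  "bounded_zygmund_variation a b \<phi> \<longleftrightarrow>
     continuous_on {a..b} \<phi> \<and>
     (\<exists>B>0. \<forall>n x. interval_partition a b n x \<longrightarrow>
        (\<Sum>i<n. \<bar>\<phi> (x i) + \<phi> (x (i + 1)) - 2 * \<phi> ((x i + x (i + 1)) / 2)\<bar>) \<le> B)"

definition bounded_quadratic_variation :: "real \<Rightarrow> real \<Rightarrow> (real \<Rightarrow> real) \<Rightarrow> bool" where
  "bounded_quadratic_variation a b \<phi> \<longleftrightarrow>
     continuous_on {a..b} \<phi> \<and>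
     (\<exists>B>0. \<forall>n x. interval_partition a b n x \<longrightarrow>
        (\<Sum>i<n. (\<phi> (x (i + 1)) - \<phi> (x i))\<^sup>2) \<le> B)"

end

theory Submission
  imports Defs
begin

text \<open>Both variations are controlled by the same principle: if each term of the sum is at most a
  constant times the length of its cell, the lengths telescope and the sum is at most that constant
  times the length of the interval (\<open>partition_sum_le\<close>).

  For the Zygmund variation such a bound is the Zygmund condition itself, applied at the midpoint
  of the cell. For the quadratic variation it says that \<open>\<phi>\<close> is Hoelder continuous of exponent
  \<open>1/2\<close>, which is \<open>zygmund_increment_square_le\<close>. The classical estimate for Zygmund functions, a
  modulus of continuity of order \<open>h log (1/h)\<close>, is stronger, but the exponent \<open>1/2\<close> is all
  that squared increments require. It comes from doubling: a cell of length \<open>h\<close> is one half of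
  a cell of length \<open>2 h\<close> inside the interval, and up to an error of order \<open>h\<close> its increment is half
  of the increment over the doubled cell. Halving the increment divides its square by four while
  the length is only divided by two, and this slack absorbs the error. After finitely many
  doublings the cell has length comparable to the whole interval, where it suffices that \<open>\<phi>\<close>
  is bounded.\<close>

lemma partition_sum_le:
  fixes f :: "real \<Rightarrow> real \<Rightarrow> real"
  assumes part: "interval_partition a b n x"
    and f: "\<And>u v. a \<le> u \<Longrightarrow> u < v \<Longrightarrow> v \<le> b \<Longrightarrow> f u v \<le> K * (v - u)"
  shows "(\<Sum>i<n. f (x i) (x (i + 1))) \<le> K * (b - a)"
proof -
  have mono: "strict_mono_on {0..n} x" and ends: "x 0 = a" "x n = b"
    using part by (auto simp: interval_partition_def)
  have "(\<Sum>i<n. f (x i) (x (i + 1))) \<le> (\<Sum>i<n. K * (x (Suc i) - x i))"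
  proof (rule sum_mono)
    fix i assume "i \<in> {..<n}"
    then have i: "i < n" by simp
    have "x 0 \<le> x i" "x i < x (i + 1)" "x (i + 1) \<le> x n"
      using strict_mono_on_leD[OF mono] strict_mono_onD[OF mono] i by auto
    then show "f (x i) (x (i + 1)) \<le> K * (x (Suc i) - x i)"
      using f ends by simp
  qed
  also have "\<dots> = K * (\<Sum>i<n. x (Suc i) - x i)"
    by (simp add: sum_distrib_left)
  also have "\<dots> = K * (b - a)"
    by (simp add: sum_lessThan_telescope ends)
  finally show ?thesis .
qed

lemma zygmund_conditionE:
  assumes "zygmund_condition {a..b} \<phi>"
  obtains B where "B > 0"
    and "\<And>u v. a \<le> u \<Longrightarrow> u < v \<Longrightarrow> v \<le> b \<Longrightarrow>
           \<bar>\<phi> u + \<phi> v - 2 * \<phi> ((u + v) / 2)\<bar> \<le> B * (v - u)"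
proof -
  from assms obtain B where "B > 0" and B: "\<And>x t. t \<noteq> 0 \<Longrightarrow> x - t \<in> {a..b} \<Longrightarrow> x \<in> {a..b} \<Longrightarrow>
      x + t \<in> {a..b} \<Longrightarrow> \<bar>(\<phi> (x + t) + \<phi> (x - t) - 2 * \<phi> x) / t\<bar> \<le> B"
    unfolding zygmund_condition_def by blast
  show ?thesis
  proof (rule that[of "B / 2"])
    show "B / 2 > 0" using \<open>B > 0\<close> by simp
  next
    fix u v assume uv: "a \<le> u" "u < v" "v \<le> b"
    define m t where "m = (u + v) / 2" and "t = (v - u) / 2"
    have mt: "m - t = u" "m + t = v" "t > 0"
      using uv by (auto simp: m_def t_def field_simps)
    have "\<bar>(\<phi> v + \<phi> u - 2 * \<phi> m) / t\<bar> \<le> B"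
      using B[of t m] mt uv by (auto simp: m_def)
    then have "\<bar>\<phi> v + \<phi> u - 2 * \<phi> m\<bar> \<le> B * t"
      using mt by (simp add: abs_divide pos_divide_le_eq)
    then show "\<bar>\<phi> u + \<phi> v - 2 * \<phi> ((u + v) / 2)\<bar> \<le> B / 2 * (v - u)"
      by (simp add: m_def t_def add.commute)
  qed
qed

text \<open>One doubling step. Splitting the square as \<open>(p + q)\<^sup>2 \<le> 3/2 p\<^sup>2 + 3 q\<^sup>2\<close>, the increment
  over the doubled cell contributes \<open>3/2 \<cdot> 1/4 \<cdot> 2 = 3/4\<close> of \<open>K h\<close>, so the error of order \<open>h\<^sup>2\<close> has
  to fit into \<open>K h / 4\<close>. The equal weights \<open>(p + q)\<^sup>2 \<le> 2 p\<^sup>2 + 2 q\<^sup>2\<close> would leave no room.\<close>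

lemma half_increment_square_le:
  fixes d e h K B L :: real
  assumes "\<bar>2 * d - e\<bar> \<le> B * (2 * h)" "e\<^sup>2 \<le> K * (2 * h)"
    and "0 < h" "h \<le> L" "12 * B\<^sup>2 * L \<le> K"
  shows "d\<^sup>2 \<le> K * h"
proof -
  define q where "q = d - e / 2"
  have "\<bar>q\<bar> \<le> B * h" using assms(1) by (simp add: q_def)
  then have "q\<^sup>2 \<le> (B * h)\<^sup>2"
    using power_mono[of "\<bar>q\<bar>" "B * h" 2] by simp
  also have "\<dots> = B\<^sup>2 * h * h" by (simp add: power2_eq_square)
  also have "\<dots> \<le> B\<^sup>2 * h * L"
    using assms(3,4) by (intro mult_left_mono) auto
  finally have "12 * q\<^sup>2 \<le> 12 * B\<^sup>2 * L * h" by (simp add: algebra_simps)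
  also have "\<dots> \<le> K * h" using assms(3,5) by (intro mult_right_mono) auto
  finally have q: "12 * q\<^sup>2 \<le> K * h" .
  have "0 \<le> (e / 2 - 2 * q)\<^sup>2" by simp
  then have "d\<^sup>2 \<le> 3 / 8 * e\<^sup>2 + 3 * q\<^sup>2"
    by (simp add: q_def power2_eq_square algebra_simps)
  with q assms(2) show ?thesis by simp
qed

lemma zygmund_increment_square_le:
  fixes a b :: real
  assumes zyg: "\<And>u v. a \<le> u \<Longrightarrow> u < v \<Longrightarrow> v \<le> b \<Longrightarrow>
           \<bar>\<phi> u + \<phi> v - 2 * \<phi> ((u + v) / 2)\<bar> \<le> B * (v - u)"
    and bdd: "\<And>u. a \<le> u \<Longrightarrow> u \<le> b \<Longrightarrow> \<bar>\<phi> u\<bar> \<le> M"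
    and uv: "a \<le> u" "u < v" "v \<le> b"
  shows "(\<phi> v - \<phi> u)\<^sup>2 \<le> (12 * B\<^sup>2 * (b - a) + 12 * M\<^sup>2 / (b - a)) * (v - u)"
proof -
  define L where "L = b - a"
  define K where "K = 12 * B\<^sup>2 * L + 12 * M\<^sup>2 / L"
  have L: "L > 0" using uv by (simp add: L_def)
  then have K: "12 * B\<^sup>2 * L \<le> K" "12 * M\<^sup>2 / L \<le> K" by (simp_all add: K_def)
  have long: "(\<phi> v - \<phi> u)\<^sup>2 \<le> K * (v - u)"
    if "a \<le> u" "u < v" "v \<le> b" "L / 3 \<le> v - u" for u v
  proof -
    have "\<bar>\<phi> v - \<phi> u\<bar> \<le> 2 * M"
      using bdd[of u] bdd[of v] that by linarith
    then have "(\<phi> v - \<phi> u)\<^sup>2 \<le> (2 * M)\<^sup>2"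
      using power_mono[of "\<bar>\<phi> v - \<phi> u\<bar>" "2 * M" 2] by simp
    also have "\<dots> = 12 * M\<^sup>2 / L * (L / 3)" using L by simp
    also have "\<dots> \<le> K * (v - u)"
    proof (rule mult_mono)
      show "0 \<le> K" using K(1) L by (smt (verit) zero_le_power2 mult_nonneg_nonneg)
    qed (use K that L in auto)
    finally show ?thesis .
  qed
  have "(\<phi> v - \<phi> u)\<^sup>2 \<le> K * (v - u)"
    if "a \<le> u" "u < v" "v \<le> b" "L / 3 \<le> (v - u) * 2 ^ n" for n u v
    using that
  proof (induction n arbitrary: u v)
    case 0
    then show ?case using long by simp
  next
    case (Suc n)
    show ?case
    proof (cases "L / 3 \<le> v - u")
      case True
      then show ?thesis using long Suc.prems by simp
    next
      case False
      define h where "h = v - u"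
      have h: "0 < h" "h \<le> L" "v = u + h" using False Suc.prems L by (auto simp: h_def)
      have n: "L / 3 \<le> (2 * h) * 2 ^ n" using Suc.prems(4) by (simp add: h_def algebra_simps)
      \<comment> \<open>The gaps to the left and to the right of the cell cannot both be shorter than \<open>h < L / 3\<close>.\<close>
      have "v + h \<le> b \<or> a \<le> u - h"
        using False unfolding h_def L_def by argo
      then consider "v + h \<le> b" | "a \<le> u - h" by blast
      then show ?thesis
      proof cases
        case 1
        define w where "w = u + 2 * h"
        have w: "w - u = 2 * h" "(u + w) / 2 = v" "u < w" "w \<le> b"
          using 1 h by (simp_all add: w_def)
        have "(\<phi> w - \<phi> u)\<^sup>2 \<le> K * (2 * h)"
          using Suc.IH[of u w] Suc.prems w n by simp
        moreover have "\<bar>\<phi> u + \<phi> w - 2 * \<phi> v\<bar> \<le> B * (2 * h)"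
          using zyg[of u w, unfolded w] Suc.prems w by simp
        then have "\<bar>2 * (\<phi> v - \<phi> u) - (\<phi> w - \<phi> u)\<bar> \<le> B * (2 * h)"
          by argo
        ultimately have "(\<phi> v - \<phi> u)\<^sup>2 \<le> K * h"
          using half_increment_square_le h K(1) by blast
        then show ?thesis by (simp add: h_def)
      next
        case 2
        define w where "w = v - 2 * h"
        have w: "v - w = 2 * h" "(w + v) / 2 = u" "w < v" "a \<le> w"
          using 2 h by (simp_all add: w_def)
        have "(\<phi> v - \<phi> w)\<^sup>2 \<le> K * (2 * h)"
          using Suc.IH[of w v] Suc.prems w n by simp
        moreover have "\<bar>\<phi> w + \<phi> v - 2 * \<phi> u\<bar> \<le> B * (2 * h)"
          using zyg[of w v, unfolded w] Suc.prems w by simp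
        then have "\<bar>2 * (\<phi> v - \<phi> u) - (\<phi> v - \<phi> w)\<bar> \<le> B * (2 * h)"
          by argo
        ultimately have "(\<phi> v - \<phi> u)\<^sup>2 \<le> K * h"
          using half_increment_square_le h K(1) by blast
        then show ?thesis by (simp add: h_def)
      qed
    qed
  qed
  moreover obtain n where "L / 3 / (v - u) < 2 ^ n"
    using real_arch_pow[of 2 "L / 3 / (v - u)"] by auto
  then have "L / 3 \<le> (v - u) * 2 ^ n"
    using uv by (simp add: pos_divide_less_eq algebra_simps)
  ultimately show ?thesis using uv unfolding K_def L_def by blast
qed

theorem mainTheorem3:
  fixes a b :: real and \<phi> :: "real \<Rightarrow> real"
  assumes "a \<le> b"
    and "zygmund_condition {a..b} \<phi>"
  shows "bounded_zygmund_variation a b \<phi> \<and> bounded_quadratic_variation a b \<phi>"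
proof -
  have cont: "continuous_on {a..b} \<phi>"
    using assms(2) by (simp add: zygmund_condition_def)
  then have "bounded (\<phi> ` {a..b})"
    by (simp add: compact_continuous_image compact_imp_bounded)
  then obtain M where M: "\<And>u. a \<le> u \<Longrightarrow> u \<le> b \<Longrightarrow> \<bar>\<phi> u\<bar> \<le> M"
    unfolding bounded_iff by (metis atLeastAtMost_iff image_eqI real_norm_def)
  obtain B where "B > 0" and B: "\<And>u v. a \<le> u \<Longrightarrow> u < v \<Longrightarrow> v \<le> b \<Longrightarrow>
      \<bar>\<phi> u + \<phi> v - 2 * \<phi> ((u + v) / 2)\<bar> \<le> B * (v - u)"
    using zygmund_conditionE[OF assms(2)] by blast
  define K where "K = 12 * B\<^sup>2 * (b - a) + 12 * M\<^sup>2 / (b - a)"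
  have K: "(\<phi> v - \<phi> u)\<^sup>2 \<le> K * (v - u)" if "a \<le> u" "u < v" "v \<le> b" for u v
    unfolding K_def using zygmund_increment_square_le[OF B M that] .
  have "K \<ge> 0" using assms(1) by (simp add: K_def)
  \<comment> \<open>The summand 1 keeps the bounds positive in the degenerate case \<open>a = b\<close>.\<close>
  have "bounded_zygmund_variation a b \<phi>"
    unfolding bounded_zygmund_variation_def
  proof (intro conjI cont exI[of _ "B * (b - a) + 1"] allI impI)
    show "0 < B * (b - a) + 1"
      using \<open>B > 0\<close> assms(1) by (simp add: add_nonneg_pos)
  next
    fix n x assume "interval_partition a b n x"
    from partition_sum_le[OF this, of "\<lambda>u v. \<bar>\<phi> u + \<phi> v - 2 * \<phi> ((u + v) / 2)\<bar>" B] B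
    show "(\<Sum>i<n. \<bar>\<phi> (x i) + \<phi> (x (i + 1)) - 2 * \<phi> ((x i + x (i + 1)) / 2)\<bar>)
        \<le> B * (b - a) + 1" by simp
  qed
  moreover have "bounded_quadratic_variation a b \<phi>"
    unfolding bounded_quadratic_variation_def
  proof (intro conjI cont exI[of _ "K * (b - a) + 1"] allI impI)
    show "0 < K * (b - a) + 1"
      using \<open>K \<ge> 0\<close> assms(1) by (simp add: add_nonneg_pos)
  next
    fix n x assume "interval_partition a b n x"
    from partition_sum_le[OF this, of "\<lambda>u v. (\<phi> v - \<phi> u)\<^sup>2" K] K
    show "(\<Sum>i<n. (\<phi> (x (i + 1)) - \<phi> (x i))\<^sup>2) \<le> K * (b - a) + 1" by simp
  qed
  ultimately show ?thesis ..
qed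

end
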